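(* (Time reversibility 1.) Let $R \in \mathcal{P}$ be a reachable RMPC process. If every backward rate is equal to the corresponding forward rate (i.e., $\overline{\lambda} = \lambda$ for all $\lambda\in\mathbb R_{>0}$), then the underlying CTMC $\mathcal{M}[\![R]\!]$ is time reversible.
   Context: RMPC. Fix a countable set $\mathcal{A}$ of actions, rates in $\mathbb{R}_{>0}$, and a countable set $\mathcal{K}$ of keys. Forward processes: $P,Q ::= \mathbf{0} \mid \langle a,\lambda\rangle.P \mid P+Q \mid P\parallel_L Q$ ($L\subseteq\mathcal A$); reversible processes: $R,S ::= P \mid \langle a,\lambda\rangle[i].R \mid R+S \mid R\parallel_L S$ ($i\in\mathcal K$). $\mathrm{std}(R)$ means $R$ is a forward process; $\mathrm{key}(R)$ is the set of keys occurring in $R$. Every rate $\lambda$ has an associated backward rate $\overline{\lambda}>0$. Forward $\to$ and backward $\rightsquigarrow$ transition relations are the least relations closed under (symmetric variants of Cho, Par, Cho$^r$, Par$^r$ included): (Act1) if $\mathrm{std}(R)$ then $\langle a,\lambda\rangle.R \xrightarrow{\langle a,\lambda\rangle[i]} \langle a,\lambda\rangle[i].R$ for every $i\in\mathcal K$; (Act1$^r$) if $\mathrm{std}(R)$ then $\langle a,\lambda\rangle[i].R \rightsquigarrow^{\langle a,\overline\lambda\rangle[i]} \langle a,\lambda\rangle.R$. (Act2) if $R\xrightarrow{\langle b,\mu\rangle[j]}R'$ and $j\neq i$ then $\langle a,\lambda\rangle[i].R\xrightarrow{\langle b,\mu\rangle[j]}\langle a,\lambda\rangle[i].R'$; (Act2$^r$)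 the same with $\rightsquigarrow$ and label $\langle b,\overline\mu\rangle[j]$. (Cho) if $R\xrightarrow{\ell}R'$ and $\mathrm{std}(S)$ then $R+S\xrightarrow{\ell}R'+S$; (Cho$^r$) the same with $\rightsquigarrow$. (Par) if $R\xrightarrow{\langle a,\lambda\rangle[i]}R'$, $a\notin L$, $i\notin\mathrm{key}(S)$ then $R\parallel_L S\xrightarrow{\langle a,\lambda\rangle[i]}R'\parallel_L S$; (Par$^r$) the same with $\rightsquigarrow$. (Coo) if $R\xrightarrow{\langle a,\lambda\rangle[i]}R'$, $S\xrightarrow{\langle a,\mu\rangle[i]}S'$, $a\in L$ then $R\parallel_L S\xrightarrow{\langle a,\lambda\cdot\mu\rangle[i]}R'\parallel_L S'$; (Coo$^r$) if $R\rightsquigarrow^{\langle a,\overline\lambda\rangle[i]}R'$, $S\rightsquigarrow^{\langle a,\overline\mu\rangle[i]}S'$, $a\in L$ then $R\parallel_L S\rightsquigarrow^{\langle a,\overline\lambda\cdot\overline\mu\rangle[i]}R'\parallel_L S'$. $\mathcal P$ (reachable processes) = forward processes plus all processes obtained from them by finitely many forward transitions. Process contexts: $\mathcal C ::= \bullet \mid \langle a,\lambda\rangle[i].\mathcal C \mid R+\mathcal C \mid \mathcal C+R \mid R\parallel_L\mathcal C \mid \mathcal C\parallel_L R$. $\equiv_{\mathcal K}$ is the smallest equivalence relation on $\mathcal P$ such that: (i) if $\mathcal C$ contains no $\parallel_L$ with $a\in L$ and $i,j$ do not occur in $\mathcal C$ and $R$, then $\mathcal C[\langle a,\lambda\rangle[i].R]\equiv_{\mathcal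 K}\mathcal C[\langle a,\lambda\rangle[j].R]$; (ii) if $n\ge 2$, $a\in L_1\cap\dots\cap L_{n-1}$, $i,j$ do not occur in $\mathcal C,\mathcal C_1,\dots,\mathcal C_n,R_1,\dots,R_n$, and no further $a$ with key $i$ occurs in $\mathcal C$, then $\mathcal C[\mathcal C_1[\langle a,\lambda_1\rangle[i].R_1]\parallel_{L_1}\dots\parallel_{L_{n-1}}\mathcal C_n[\langle a,\lambda_n\rangle[i].R_n]]\equiv_{\mathcal K}$ the same term with $i$ replaced by $j$ in these $n$ prefixes. The underlying CTMC $\mathcal M[\![R]\!]$ has as states the $\equiv_{\mathcal K}$-classes reachable from the initial state $[R]_{\equiv_{\mathcal K}}$, a transition $[S]\xrightarrow{\langle a,\lambda\rangle}[S']$ whenever $S\xrightarrow{\langle a,\lambda\rangle[i]}S'$ for some $i$, and a transition $[S]\rightsquigarrow^{\langle a,\overline\lambda\rangle}[S']$ whenever $S\rightsquigarrow^{\langle a,\overline\lambda\rangle[i]}S'$ for some $i$; it is the continuous-time Markov chain whose rate $q_{s,s'}$ from $s$ to $s'\neq s$ is the sum of the rates of all transitions from $s$ to $s'$. A stationary CTMC $X(t)$ is time reversible iff $(X(t_1),\dots,X(t_n))$ and $(X(t'-t_1),\dots,X(t'-t_n))$ have the same joint distribution for all $n\ge1$, $t_1<\dots<t_n$, $t'$; equivalently, iff its steady-state distribution $\pi$ satisfies the partial balance equations $\pi(s)q_{s,s'}=\pi(s')q_{s',s}$ for all $s\neq s'$.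
   Formalization: In clause (ii) of key equivalence, bracketed subgroups of the synchronizing parallel composition may lie in contexts of their own; in clause (i) only operators with the hole in scope count. Read literally, some processes have infinitely many successor classes and no CTMC. *)

theory Defs
  imports "HOL-Probability.Probability"
begin

section \<open>Reversible processes\<close>

typedef rate = "{x :: real. 0 < x}"
  morphisms rate_val Rate
  by (rule exI[of _ 1]) simp

text \<open>
  The type also contains terms such as \<open>Pre a \<lambda> (Past b \<mu> i Stop)\<close>, which the grammar of
  reversible processes excludes.  They are never reachable: the \<open>std\<close> side conditions of the
  rules keep transitions between terms of the grammar, and everything below is restricted to
  \<open>reachable\<close>.
\<close>

datatype ('a, 'k) proc =
    Stop
  | Pre 'a rate "('a, 'k) proc"
  | Past 'a rate 'k "('a, 'k) proc"
  | Choice "('a, 'k) proc" "('a, 'k) proc"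
  | Par "('a, 'k) proc" "'a set" "('a, 'k) proc"

text \<open>\<open>std R\<close>: \<open>R\<close> is a forward process.\<close>

primrec std :: "('a, 'k) proc \<Rightarrow> bool" where
  "std Stop \<longleftrightarrow> True"
| "std (Pre a l R) \<longleftrightarrow> std R"
| "std (Past a l i R) \<longleftrightarrow> False"
| "std (Choice R S) \<longleftrightarrow> std R \<and> std S"
| "std (Par R L S) \<longleftrightarrow> std R \<and> std S"

primrec keys :: "('a, 'k) proc \<Rightarrow> 'k set" where
  "keys Stop = {}"
| "keys (Pre a l R) = keys R"
| "keys (Past a l i R) = insert i (keys R)"
| "keys (Choice R S) = keys R \<union> keys S"
| "keys (Par R L S) = keys R \<union> keys S"

text \<open>
  \<open>fstep R a r i R'\<close> and \<open>bstep bk R a r i R'\<close> are the forward and the backward transition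
  with label \<open>\<langle>a,r\<rangle>[i]\<close>; \<open>bk\<close> maps every rate to its backward rate.
\<close>

inductive fstep :: "('a, 'k) proc \<Rightarrow> 'a \<Rightarrow> real \<Rightarrow> 'k \<Rightarrow> ('a, 'k) proc \<Rightarrow> bool" where
  Act1: "std R \<Longrightarrow> fstep (Pre a l R) a (rate_val l) i (Past a l i R)"
| Act2: "fstep R b r j R' \<Longrightarrow> j \<noteq> i \<Longrightarrow> fstep (Past a l i R) b r j (Past a l i R')"
| ChoL: "fstep R a r i R' \<Longrightarrow> std S \<Longrightarrow> fstep (Choice R S) a r i (Choice R' S)"
| ChoR: "fstep S a r i S' \<Longrightarrow> std R \<Longrightarrow> fstep (Choice R S) a r i (Choice R S')"
| ParL: "fstep R a r i R' \<Longrightarrow> a \<notin> L \<Longrightarrow> i \<notin> keys S \<Longrightarrow> fstep (Par R L S) a r i (Par R' L S)"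
| ParR: "fstep S a r i S' \<Longrightarrow> a \<notin> L \<Longrightarrow> i \<notin> keys R \<Longrightarrow> fstep (Par R L S) a r i (Par R L S')"
| Coo:  "fstep R a r i R' \<Longrightarrow> fstep S a u i S' \<Longrightarrow> a \<in> L
          \<Longrightarrow> fstep (Par R L S) a (r * u) i (Par R' L S')"

inductive bstep :: "(rate \<Rightarrow> rate) \<Rightarrow> ('a, 'k) proc \<Rightarrow> 'a \<Rightarrow> real \<Rightarrow> 'k \<Rightarrow> ('a, 'k) proc \<Rightarrow> bool"
  for bk :: "rate \<Rightarrow> rate" where
  Act1r: "std R \<Longrightarrow> bstep bk (Past a l i R) a (rate_val (bk l)) i (Pre a l R)"
| Act2r: "bstep bk R b r j R' \<Longrightarrow> j \<noteq> i \<Longrightarrow> bstep bk (Past a l i R) b r j (Past a l i R')"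
| ChoLr: "bstep bk R a r i R' \<Longrightarrow> std S \<Longrightarrow> bstep bk (Choice R S) a r i (Choice R' S)"
| ChoRr: "bstep bk S a r i S' \<Longrightarrow> std R \<Longrightarrow> bstep bk (Choice R S) a r i (Choice R S')"
| ParLr: "bstep bk R a r i R' \<Longrightarrow> a \<notin> L \<Longrightarrow> i \<notin> keys S
           \<Longrightarrow> bstep bk (Par R L S) a r i (Par R' L S)"
| ParRr: "bstep bk S a r i S' \<Longrightarrow> a \<notin> L \<Longrightarrow> i \<notin> keys R
           \<Longrightarrow> bstep bk (Par R L S) a r i (Par R L S')"
| Coor:  "bstep bk R a r i R' \<Longrightarrow> bstep bk S a u i S' \<Longrightarrow> a \<in> L
           \<Longrightarrow> bstep bk (Par R L S) a (r * u) i (Par R' L S')"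

inductive_set reachable :: "('a, 'k) proc set" where
  base: "std P \<Longrightarrow> P \<in> reachable"
| step: "R \<in> reachable \<Longrightarrow> fstep R a r i R' \<Longrightarrow> R' \<in> reachable"


section \<open>Equivalence up to keys\<close>

datatype ('a, 'k) ctx =
    Hole
  | CPast 'a rate 'k "('a, 'k) ctx"
  | CChoR "('a, 'k) proc" "('a, 'k) ctx"
  | CChoL "('a, 'k) ctx" "('a, 'k) proc"
  | CParR "('a, 'k) proc" "'a set" "('a, 'k) ctx"
  | CParL "('a, 'k) ctx" "'a set" "('a, 'k) proc"

primrec fill :: "('a, 'k) ctx \<Rightarrow> ('a, 'k) proc \<Rightarrow> ('a, 'k) proc" where
  "fill Hole T = T"
| "fill (CPast a l i C) T = Past a l i (fill C T)"
| "fill (CChoR R C) T = Choice R (fill C T)"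
| "fill (CChoL C R) T = Choice (fill C T) R"
| "fill (CParR R L C) T = Par R L (fill C T)"
| "fill (CParL C L R) T = Par (fill C T) L R"

primrec ckeys :: "('a, 'k) ctx \<Rightarrow> 'k set" where
  "ckeys Hole = {}"
| "ckeys (CPast a l i C) = insert i (ckeys C)"
| "ckeys (CChoR R C) = keys R \<union> ckeys C"
| "ckeys (CChoL C R) = ckeys C \<union> keys R"
| "ckeys (CParR R L C) = keys R \<union> ckeys C"
| "ckeys (CParL C L R) = ckeys C \<union> keys R"

text \<open>
  The synchronisation sets of a context are those of the parallel operators that build the
  context, i.e. that have the hole in their scope.  Operators inside the side processes do not
  count, since they do not affect the prefix put into the hole.
\<close>

primrec csyncs :: "('a, 'k) ctx \<Rightarrow> 'a set set" where
  "csyncs Hole = {}"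
| "csyncs (CPast a l i C) = csyncs C"
| "csyncs (CChoR R C) = csyncs C"
| "csyncs (CChoL C R) = csyncs C"
| "csyncs (CParR R L C) = insert L (csyncs C)"
| "csyncs (CParL C L R) = insert L (csyncs C)"

text \<open>
  \<open>sync_ren a i j n T T'\<close>: \<open>T\<close> contains \<open>n\<close> prefixes \<open>\<langle>a,\<lambda>\<^sub>1\<rangle>[i].R\<^sub>1, \<dots>, \<langle>a,\<lambda>\<^sub>n\<rangle>[i].R\<^sub>n\<close>, each in its
  own context \<open>C\<^sub>k\<close>, that are combined by \<open>n - 1\<close> parallel operators whose sets all contain \<open>a\<close>,
  the whole lying in a context \<open>C\<close>; neither \<open>i\<close> nor \<open>j\<close> occurs anywhere else (so in particular
  no further \<open>a\<close> with key \<open>i\<close> occurs), and \<open>T'\<close> is \<open>T\<close> with \<open>i\<close> replaced by \<open>j\<close> in these prefixes.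
  The parallel operators may be bracketed in any way, and a bracketed group may itself be in a
  context, as in \<open>((\<langle>a,\<lambda>\<^sub>1\<rangle>[i].R\<^sub>1 \<parallel>\<^sub>L \<langle>a,\<lambda>\<^sub>2\<rangle>[i].R\<^sub>2) + Q) \<parallel>\<^sub>K \<langle>a,\<lambda>\<^sub>3\<rangle>[i].R\<^sub>3\<close>: such synchronisations
  arise from rule Coo.  Without the latter, this term would be equivalent to no variant with
  another key, and the unsynchronised process would have one successor state per key.
\<close>

inductive sync_ren :: "'a \<Rightarrow> 'k \<Rightarrow> 'k \<Rightarrow> nat \<Rightarrow> ('a, 'k) proc \<Rightarrow> ('a, 'k) proc \<Rightarrow> bool"
  for a :: 'a and i j :: 'k where
  leaf: "i \<notin> ckeys C \<union> keys R \<Longrightarrow> j \<notin> ckeys C \<union> keys R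
    \<Longrightarrow> sync_ren a i j 1 (fill C (Past a l i R)) (fill C (Past a l j R))"
| node: "sync_ren a i j m T T' \<Longrightarrow> sync_ren a i j n U U' \<Longrightarrow> a \<in> L
    \<Longrightarrow> i \<notin> ckeys C \<Longrightarrow> j \<notin> ckeys C
    \<Longrightarrow> sync_ren a i j (m + n) (fill C (Par T L U)) (fill C (Par T' L U'))"

inductive key_equiv :: "('a, 'k) proc \<Rightarrow> ('a, 'k) proc \<Rightarrow> bool" (infix \<open>\<equiv>\<^sub>K\<close> 50) where
  refl: "R \<in> reachable \<Longrightarrow> R \<equiv>\<^sub>K R"
| sym: "R \<equiv>\<^sub>K S \<Longrightarrow> S \<equiv>\<^sub>K R"
| trans: "R \<equiv>\<^sub>K S \<Longrightarrow> S \<equiv>\<^sub>K T \<Longrightarrow> R \<equiv>\<^sub>K T"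
| single: "fill C (Past a l i R) \<in> reachable \<Longrightarrow> fill C (Past a l j R) \<in> reachable
    \<Longrightarrow> (\<forall>L \<in> csyncs C. a \<notin> L)
    \<Longrightarrow> i \<notin> ckeys C \<union> keys R \<Longrightarrow> j \<notin> ckeys C \<union> keys R
    \<Longrightarrow> fill C (Past a l i R) \<equiv>\<^sub>K fill C (Past a l j R)"
| sync: "T \<in> reachable \<Longrightarrow> T' \<in> reachable \<Longrightarrow> sync_ren a i j n T T' \<Longrightarrow> n \<ge> 2 \<Longrightarrow> T \<equiv>\<^sub>K T'"


section \<open>Continuous-time Markov chains\<close>

text \<open>
  A chain is given by its set \<open>S\<close> of states and its rates \<open>q s s'\<close> for distinct states;
  the values \<open>q s s\<close> are never used.
\<close>

definition steady_state :: "'s set \<Rightarrow> ('s \<Rightarrow> 's \<Rightarrow> real) \<Rightarrow> ('s \<Rightarrow> real) \<Rightarrow> bool" where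
  "steady_state S q \<pi> \<longleftrightarrow>
     (\<forall>s \<in> S. 0 \<le> \<pi> s) \<and> (\<forall>s. s \<notin> S \<longrightarrow> \<pi> s = 0) \<and> (\<pi> has_sum 1) S \<and>
     (\<forall>s \<in> S. q s summable_on (S - {s}) \<and>
        ((\<lambda>s'. \<pi> s' * q s' s) has_sum (\<pi> s * (\<Sum>\<^sub>\<infinity>s' \<in> S - {s}. q s s'))) (S - {s}))"

definition partial_balance :: "'s set \<Rightarrow> ('s \<Rightarrow> 's \<Rightarrow> real) \<Rightarrow> ('s \<Rightarrow> real) \<Rightarrow> bool" where
  "partial_balance S q \<pi> \<longleftrightarrow> (\<forall>s \<in> S. \<forall>s' \<in> S. s \<noteq> s' \<longrightarrow> \<pi> s * q s s' = \<pi> s' * q s' s)"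

text \<open>Joint distribution of \<open>(X(t\<^sub>0), \<dots>, X(t\<^sub>n\<^sub>-\<^sub>1))\<close>.\<close>

definition joint ::
    "'w measure \<Rightarrow> (real \<Rightarrow> 'w \<Rightarrow> 's) \<Rightarrow> 's set \<Rightarrow> nat \<Rightarrow> (nat \<Rightarrow> real) \<Rightarrow> (nat \<Rightarrow> 's) measure" where
  "joint M X S n t =
     distr M (Pi\<^sub>M {..<n} (\<lambda>_. count_space S)) (\<lambda>\<omega>. \<lambda>k\<in>{..<n}. X (t k) \<omega>)"

definition stationary :: "'w measure \<Rightarrow> (real \<Rightarrow> 'w \<Rightarrow> 's) \<Rightarrow> 's set \<Rightarrow> bool" where
  "stationary M X S \<longleftrightarrow>
     (\<forall>n t \<tau>. strict_mono_on {..<n} t \<longrightarrow> joint M X S n (\<lambda>k. t k + \<tau>) = joint M X S n t)"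

definition time_reversible :: "'w measure \<Rightarrow> (real \<Rightarrow> 'w \<Rightarrow> 's) \<Rightarrow> 's set \<Rightarrow> bool" where
  "time_reversible M X S \<longleftrightarrow>
     (\<forall>n \<ge> 1. \<forall>t t'. strict_mono_on {..<n} t \<longrightarrow>
        joint M X S n t = joint M X S n (\<lambda>k. t' - t k))"

definition markov :: "'w measure \<Rightarrow> (real \<Rightarrow> 'w \<Rightarrow> 's) \<Rightarrow> 's set \<Rightarrow> bool" where
  "markov M X S \<longleftrightarrow>
     (\<forall>(n::nat) t u s s'. strict_mono_on {..n} t \<and> t n < u \<and> s ` {..n} \<subseteq> S \<and> s' \<in> S \<and>
        \<P>(\<omega> in M. \<forall>k\<le>n. X (t k) \<omega> = s k) > 0 \<longrightarrow>
        \<P>(\<omega> in M. X u \<omega> = s' \<bar> \<forall>k\<le>n. X (t k) \<omega> = s k)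
          = \<P>(\<omega> in M. X u \<omega> = s' \<bar> X (t n) \<omega> = s n))"

definition has_rates ::
    "'w measure \<Rightarrow> (real \<Rightarrow> 'w \<Rightarrow> 's) \<Rightarrow> 's set \<Rightarrow> ('s \<Rightarrow> 's \<Rightarrow> real) \<Rightarrow> bool" where
  "has_rates M X S q \<longleftrightarrow>
     (\<forall>t. \<forall>s \<in> S. \<forall>s' \<in> S. s \<noteq> s' \<and> \<P>(\<omega> in M. X t \<omega> = s) > 0 \<longrightarrow>
        ((\<lambda>h. \<P>(\<omega> in M. X (t + h) \<omega> = s' \<bar> X t \<omega> = s) / h) \<longlongrightarrow> q s s') (at_right 0))"

definition stationary_ctmc ::
    "'w measure \<Rightarrow> (real \<Rightarrow> 'w \<Rightarrow> 's) \<Rightarrow> 's set \<Rightarrow> ('s \<Rightarrow> 's \<Rightarrow> real) \<Rightarrow> bool" where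
  "stationary_ctmc M X S q \<longleftrightarrow>
     prob_space M \<and> (\<forall>t. X t \<in> measurable M (count_space S)) \<and>
     markov M X S \<and> has_rates M X S q \<and> stationary M X S"

text \<open>
  The stationary version of the chain is time reversible.  It is represented by the coordinate
  process on the path space, which is no restriction, since all the notions above depend only on
  the law of the process.  Existence and uniqueness of the steady-state distribution and the
  partial balance equations are stated along with it; for chains with infinitely many states or
  infinite exit rates, the last condition alone could hold just because there is no stationary
  version.
\<close>

definition ctmc_time_reversible :: "'s set \<Rightarrow> ('s \<Rightarrow> 's \<Rightarrow> real) \<Rightarrow> bool" where
  "ctmc_time_reversible S q \<longleftrightarrow>
     (\<exists>!\<pi>. steady_state S q \<pi>) \<and>
     (\<forall>\<pi>. steady_state S q \<pi> \<longrightarrow> partial_balance S q \<pi>) \<and>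
     (\<forall>M :: (real \<Rightarrow> 's) measure.
        stationary_ctmc M (\<lambda>t \<omega>. \<omega> t) S q \<longrightarrow> time_reversible M (\<lambda>t \<omega>. \<omega> t) S)"


section \<open>The chain underlying a process\<close>

definition key_class :: "('a, 'k) proc \<Rightarrow> ('a, 'k) proc set" where
  "key_class R = {S. R \<equiv>\<^sub>K S}"

definition ftrans :: "('a, 'k) proc set \<Rightarrow> 'a \<Rightarrow> real \<Rightarrow> ('a, 'k) proc set \<Rightarrow> bool" where
  "ftrans s a r s' \<longleftrightarrow> (\<exists>S \<in> reachable. \<exists>S' \<in> reachable. \<exists>i.
     s = key_class S \<and> s' = key_class S' \<and> fstep S a r i S')"

definition btrans ::
    "(rate \<Rightarrow> rate) \<Rightarrow> ('a, 'k) proc set \<Rightarrow> 'a \<Rightarrow> real \<Rightarrow> ('a, 'k) proc set \<Rightarrow> bool" where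
  "btrans bk s a r s' \<longleftrightarrow> (\<exists>S \<in> reachable. \<exists>S' \<in> reachable. \<exists>i.
     s = key_class S \<and> s' = key_class S' \<and> bstep bk S a r i S')"

inductive_set ctmc_states :: "(rate \<Rightarrow> rate) \<Rightarrow> ('a, 'k) proc \<Rightarrow> ('a, 'k) proc set set"
  for bk :: "rate \<Rightarrow> rate" and R :: "('a, 'k) proc" where
  init: "key_class R \<in> ctmc_states bk R"
| fwd: "s \<in> ctmc_states bk R \<Longrightarrow> ftrans s a r s' \<Longrightarrow> s' \<in> ctmc_states bk R"
| bwd: "s \<in> ctmc_states bk R \<Longrightarrow> btrans bk s a r s' \<Longrightarrow> s' \<in> ctmc_states bk R"

definition ctmc_rate ::
    "(rate \<Rightarrow> rate) \<Rightarrow> ('a, 'k) proc set \<Rightarrow> ('a, 'k) proc set \<Rightarrow> real" where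
  "ctmc_rate bk s s' =
     (\<Sum>\<^sub>\<infinity>(a, r) \<in> {(a, r). ftrans s a r s'}. r) + (\<Sum>\<^sub>\<infinity>(a, r) \<in> {(a, r). btrans bk s a r s'}. r)"

end

theory Submission
  imports Defs
begin

text \<open>
  If the backward rates equal the forward rates, every transition can be undone at the same rate,
  so the rate matrix is symmetric.  There are finitely many states: transitions preserve the
  process with all keys erased, and a key can be exchanged for a fresh one within its class, so
  boundedly many keys suffice.  A symmetric, connected, finite chain has the uniform distribution
  as its only steady state, and that distribution satisfies partial balance.

  For the trajectories, let \<open>G h s u\<close> be the probability of being in \<open>s\<close> and, \<open>h\<close> time units
  later, in \<open>u\<close>.  The total asymmetry \<open>\<Sum> \<bar>G h s u - G h u s\<bar>\<close> is subadditive in \<open>h\<close> by the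
  Chapman--Kolmogorov equation and \<open>o(h)\<close> for \<open>h \<rightarrow> 0\<close> by partial balance, hence zero; this
  replaces the matrix exponential.  By the Markov property, path probabilities are products of
  values of \<open>G\<close> and therefore invariant under time reversal.
\<close>

section \<open>Finite stationary Markov chains\<close>

locale finite_stationary_ctmc = prob_space M
  for M :: "'w measure" +
  fixes X :: "real \<Rightarrow> 'w \<Rightarrow> 's" and S :: "'s set" and q :: "'s \<Rightarrow> 's \<Rightarrow> real"
  assumes ctmc: "stationary_ctmc M X S q" and finite_states: "finite S"
begin

section \<open>Laws of the process at one and two times\<close>

definition p :: "'s \<Rightarrow> real" where
  "p s = prob {\<omega> \<in> space M. X 0 \<omega> = s}"

text \<open>A joint rather than a conditional probability: it makes sense for null states, and
  reversibility becomes symmetry of \<open>G h\<close>.\<close>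

definition G :: "real \<Rightarrow> 's \<Rightarrow> 's \<Rightarrow> real" where
  "G h s s' = prob {\<omega> \<in> space M. X 0 \<omega> = s \<and> X h \<omega> = s'}"

lemma X_meas [measurable]: "X t \<in> measurable M (count_space S)"
  using ctmc by (auto simp: stationary_ctmc_def)

lemma X_in: "\<omega> \<in> space M \<Longrightarrow> X t \<omega> \<in> S"
  using measurable_space[OF X_meas[of t]] by simp

lemma X_eq_sets: "{\<omega> \<in> space M. X t \<omega> = s} \<in> events"
proof -
  have "X t -` ({s} \<inter> S) \<inter> space M \<in> events"
    by (rule measurable_sets[OF X_meas]) auto
  moreover have "X t -` ({s} \<inter> S) \<inter> space M = {\<omega> \<in> space M. X t \<omega> = s}"
    using X_in by auto
  ultimately show ?thesis by simp
qed

lemma X_eq_pred [measurable]: "Measurable.pred M (\<lambda>\<omega>. X t \<omega> = s)"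
  using X_eq_sets[of t s] by (simp add: pred_def)

lemma path_measurable:
  "(\<lambda>\<omega>. \<lambda>k\<in>{..<n}. X (t k) \<omega>) \<in> measurable M (Pi\<^sub>M {..<n} (\<lambda>_. count_space S))"
  by (rule measurable_restrict) (rule X_meas)

text \<open>Since \<open>S\<close> is finite, the product sigma-algebra is discrete, so joint laws
  are determined by the probabilities of single paths.\<close>

lemma PiM_states:
  "Pi\<^sub>M {..<n::nat} (\<lambda>_. count_space S) = count_space (PiE {..<n} (\<lambda>_. S))"
  by (rule count_space_PiM_finite) (auto simp: finite_states countable_finite)

lemma emeasure_joint_singleton:
  assumes "x \<in> PiE {..<n} (\<lambda>_. S)"
  shows "emeasure (joint M X S n t) {x} = prob {\<omega> \<in> space M. \<forall>k<n. X (t k) \<omega> = x k}"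
proof -
  have "emeasure (joint M X S n t) {x}
      = emeasure M ((\<lambda>\<omega>. \<lambda>k\<in>{..<n}. X (t k) \<omega>) -` {x} \<inter> space M)"
    unfolding joint_def by (rule emeasure_distr[OF path_measurable]) (simp add: PiM_states assms)
  also have "(\<lambda>\<omega>. \<lambda>k\<in>{..<n}. X (t k) \<omega>) -` {x} \<inter> space M
      = {\<omega> \<in> space M. \<forall>k<n. X (t k) \<omega> = x k}"
  proof -
    have "(\<lambda>k\<in>{..<n}. X (t k) \<omega>) = x \<longleftrightarrow> (\<forall>k<n. X (t k) \<omega> = x k)" for \<omega>
      using assms by (auto simp: fun_eq_iff PiE_def extensional_def)
    then show ?thesis by auto
  qed
  finally show ?thesis by (simp add: emeasure_eq_measure)
qed

lemma joint_eqI: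
  assumes "\<And>x. x \<in> PiE {..<n} (\<lambda>_. S) \<Longrightarrow>
    prob {\<omega> \<in> space M. \<forall>k<n. X (t k) \<omega> = x k} = prob {\<omega> \<in> space M. \<forall>k<n. X (u k) \<omega> = x k}"
  shows "joint M X S n t = joint M X S n u"
proof (rule measure_eqI_finite)
  show "sets (joint M X S n t) = Pow (PiE {..<n} (\<lambda>_. S))"
    "sets (joint M X S n u) = Pow (PiE {..<n} (\<lambda>_. S))"
    by (simp_all add: joint_def PiM_states)
  show "finite (PiE {..<n} (\<lambda>_. S))"
    by (rule finite_PiE) (auto simp: finite_states)
qed (simp add: emeasure_joint_singleton assms)

lemma path_shift:
  assumes "strict_mono_on {..<n::nat} t" "\<And>k. k < n \<Longrightarrow> x k \<in> S"
  shows "prob {\<omega> \<in> space M. \<forall>k<n. X (t k + \<tau>) \<omega> = x k}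
    = prob {\<omega> \<in> space M. \<forall>k<n. X (t k) \<omega> = x k}"
proof -
  have "joint M X S n (\<lambda>k. t k + \<tau>) = joint M X S n t"
    using ctmc assms(1) by (auto simp: stationary_ctmc_def stationary_def)
  \<comment> \<open>Points of the product space are \<open>undefined\<close> outside the index set,
    hence \<open>restrict\<close>.\<close>
  then have "emeasure (joint M X S n (\<lambda>k. t k + \<tau>)) {restrict x {..<n}}
      = emeasure (joint M X S n t) {restrict x {..<n}}"
    by simp
  moreover have "restrict x {..<n} \<in> PiE {..<n} (\<lambda>_. S)"
    using assms(2) by auto
  ultimately show ?thesis
    by (simp add: emeasure_joint_singleton)
qed

lemma prob_X: "s \<in> S \<Longrightarrow> prob {\<omega> \<in> space M. X t \<omega> = s} = p s"
  using path_shift[of 1 "\<lambda>_. 0" "\<lambda>_. s" t] by (simp add: p_def monotone_on_def)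

lemma prob_X2:
  assumes "0 < h" "s \<in> S" "s' \<in> S"
  shows "prob {\<omega> \<in> space M. X t \<omega> = s \<and> X (t + h) \<omega> = s'} = G h s s'"
proof -
  have two: "(\<forall>k<2::nat. P k) \<longleftrightarrow> P 0 \<and> P 1" for P
    by (auto simp: less_2_cases_iff)
  have "strict_mono_on {..<2::nat} (\<lambda>k. if k = 0 then 0 else h)"
    using assms by (auto simp: monotone_on_def)
  then show ?thesis
    using path_shift[of 2 "\<lambda>k. if k = 0 then 0 else h" "\<lambda>k. if k = 0 then s else s'" t] assms
    unfolding two by (simp add: G_def add.commute)
qed

lemma p_nonneg: "0 \<le> p s" and G_nonneg: "0 \<le> G h s s'"
  by (simp_all add: p_def G_def)

lemma sum_state:
  assumes [measurable]: "Measurable.pred M P"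
  shows "(\<Sum>s\<in>S. prob {\<omega> \<in> space M. P \<omega> \<and> X t \<omega> = s}) = prob {\<omega> \<in> space M. P \<omega>}"
proof -
  have "prob {\<omega> \<in> space M. P \<omega>} = prob (\<Union>s\<in>S. {\<omega> \<in> space M. P \<omega> \<and> X t \<omega> = s})"
    using X_in by (intro arg_cong[where f = prob]) auto
  also have "\<dots> = (\<Sum>s\<in>S. prob {\<omega> \<in> space M. P \<omega> \<and> X t \<omega> = s})"
    by (rule finite_measure_finite_Union) (auto simp: finite_states disjoint_family_on_def)
  finally show ?thesis by simp
qed

lemma p_sum: "(\<Sum>s\<in>S. p s) = 1"
  using sum_state[of "\<lambda>_. True" 0] prob_space by (simp add: p_def)

lemma G_sum_right: "(\<Sum>s'\<in>S. G h s s') = p s"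
  unfolding G_def p_def by (rule sum_state) simp

lemma G_sum_left: "s' \<in> S \<Longrightarrow> (\<Sum>s\<in>S. G h s s') = p s'"
  using sum_state[of "\<lambda>\<omega>. X h \<omega> = s'" 0] prob_X[of s' h] by (simp add: G_def conj_commute)

lemma G_le: "G h s s' \<le> p s"
  unfolding G_def p_def by (rule finite_measure_mono) auto

text \<open>The Markov property with its denominators cleared, which covers conditioning events of
  probability zero too: there both sides vanish.\<close>

lemma path_step:
  assumes "strict_mono_on {..n::nat} t" "t n < u" "x ` {..n} \<subseteq> S" "y \<in> S"
  shows "prob {\<omega> \<in> space M. (\<forall>k\<le>n. X (t k) \<omega> = x k) \<and> X u \<omega> = y} * p (x n)
    = prob {\<omega> \<in> space M. \<forall>k\<le>n. X (t k) \<omega> = x k} * G (u - t n) (x n) y"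
proof -
  let ?A = "prob {\<omega> \<in> space M. \<forall>k\<le>n. X (t k) \<omega> = x k}"
  let ?B = "prob {\<omega> \<in> space M. (\<forall>k\<le>n. X (t k) \<omega> = x k) \<and> X u \<omega> = y}"
  have le: "?B \<le> ?A" "?A \<le> prob {\<omega> \<in> space M. X (t n) \<omega> = x n}"
    by (auto intro!: finite_measure_mono)
  have xn: "x n \<in> S" using assms(3) by auto
  show ?thesis
  proof (cases "?A > 0")
    case False
    then have "?A = 0" by (simp add: zero_less_measure_iff)
    moreover from this have "?B = 0" using le by (simp add: measure_le_0_iff)
    ultimately show ?thesis by simp
  next
    case True
    have "cond_prob M (\<lambda>\<omega>. X u \<omega> = y) (\<lambda>\<omega>. \<forall>k\<le>n. X (t k) \<omega> = x k)
        = cond_prob M (\<lambda>\<omega>. X u \<omega> = y) (\<lambda>\<omega>. X (t n) \<omega> = x n)"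
      using ctmc assms True unfolding stationary_ctmc_def markov_def by blast
    then have "?B / ?A = G (u - t n) (x n) y / p (x n)"
      using prob_X2[of "u - t n" "x n" y "t n"] prob_X[OF xn, of "t n"] assms(2,4) xn
      by (simp add: cond_prob_def conj_commute)
    moreover have "p (x n) > 0" using True le prob_X[OF xn, of "t n"] by simp
    ultimately show ?thesis using True by (simp add: field_simps)
  qed
qed

text \<open>Each summand is the probability of passing from \<open>s\<close> through
  \<open>m\<close> to \<open>u\<close>, evaluated by \<open>path_step\<close>.\<close>

lemma chapman_kolmogorov:
  assumes "0 < h" "0 < k" "s \<in> S" "u \<in> S"
  shows "G (h + k) s u = (\<Sum>m\<in>S. G h s m * G k m u / p m)"
proof -
  have "G (h + k) s u = (\<Sum>m\<in>S. prob {\<omega> \<in> space M. (X 0 \<omega> = s \<and> X (h + k) \<omega> = u) \<and> X h \<omega> = m})"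
    unfolding G_def by (rule sum_state[symmetric]) simp
  also have "\<dots> = (\<Sum>m\<in>S. G h s m * G k m u / p m)"
  proof (rule sum.cong)
    fix m assume m: "m \<in> S"
    have one: "(\<forall>k\<le>1::nat. P k) \<longleftrightarrow> P 0 \<and> P 1" for P
      by (auto simp: le_Suc_eq)
    let ?B = "prob {\<omega> \<in> space M. (X 0 \<omega> = s \<and> X (h + k) \<omega> = u) \<and> X h \<omega> = m}"
    have "?B * p m = G h s m * G k m u"
      using path_step[of 1 "\<lambda>k. if k = 0 then 0 else h" "h + k" "\<lambda>k. if k = 0 then s else m" u]
        assms m unfolding one by (simp add: G_def monotone_on_def image_subset_iff conj_ac)
    moreover have "?B \<le> p m"
      unfolding prob_X[OF m, of h, symmetric] by (rule finite_measure_mono) auto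
    \<comment> \<open>If \<open>p m = 0\<close>, the quotient is 0 by convention, and so is
      \<open>?B\<close>, being at most \<open>p m\<close>.\<close>
    ultimately show "?B = G h s m * G k m u / p m"
      by (cases "p m = 0") (auto simp: field_simps measure_le_0_iff)
  qed simp
  finally show ?thesis .
qed

lemma G_rate:
  assumes "s \<in> S" "s' \<in> S" "s \<noteq> s'"
  shows "((\<lambda>h. G h s s' / h) \<longlongrightarrow> p s * q s s') (at_right 0)"
proof (cases "p s > 0")
  case True
  have "((\<lambda>h. cond_prob M (\<lambda>\<omega>. X (0 + h) \<omega> = s') (\<lambda>\<omega>. X 0 \<omega> = s) / h) \<longlongrightarrow> q s s') (at_right 0)"
    using ctmc assms True unfolding stationary_ctmc_def has_rates_def p_def by blast
  then have "((\<lambda>h. p s * (G h s s' / p s / h)) \<longlongrightarrow> p s * q s s') (at_right 0)"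
    by (intro tendsto_mult tendsto_const) (simp add: cond_prob_def G_def p_def conj_commute)
  then show ?thesis using True by simp
next
  \<comment> \<open>\<open>has_rates\<close> is silent about null states, but there both
    \<open>G\<close> and the limit are 0.\<close>
  case False
  then have "p s = 0" using p_nonneg[of s] by simp
  moreover from this have "G h s s' = 0" for h using G_le[of h s s'] G_nonneg[of h s s'] by simp
  ultimately show ?thesis by simp
qed

text \<open>Both marginals of \<open>G h\<close> are \<open>p\<close>, so the probabilities of
  entering and of leaving \<open>s\<close> agree; dividing by \<open>h\<close> and letting
  \<open>h\<close> tend to 0 yields global balance.\<close>

lemma p_steady: "steady_state S q p"
proof -
  have "p s = 0" if "s \<notin> S" for s
  proof -
    have "{\<omega> \<in> space M. X 0 \<omega> = s} = {}" using X_in that by auto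
    then show ?thesis by (simp only: p_def measure_empty)
  qed
  moreover have "(p has_sum 1) S"
    using has_sum_finite[OF finite_states, of p] by (simp add: p_sum)
  moreover have "(\<Sum>s'\<in>S - {s}. p s' * q s' s) = p s * (\<Sum>s'\<in>S - {s}. q s s')" if s: "s \<in> S" for s
  proof (rule tendsto_unique)
    show "((\<lambda>h. \<Sum>s'\<in>S - {s}. G h s' s / h) \<longlongrightarrow> (\<Sum>s'\<in>S - {s}. p s' * q s' s)) (at_right 0)"
      by (rule tendsto_sum) (use G_rate s in auto)
    have "(\<Sum>s'\<in>S - {s}. G h s' s) = (\<Sum>s'\<in>S - {s}. G h s s')" for h
      using G_sum_left[OF s, of h] G_sum_right[of h s]
      by (simp add: sum.remove[OF finite_states s])
    then have "(\<Sum>s'\<in>S - {s}. G h s' s / h) = (\<Sum>s'\<in>S - {s}. G h s s' / h)" for h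
      by (simp flip: sum_divide_distrib)
    moreover have "((\<lambda>h. \<Sum>s'\<in>S - {s}. G h s s' / h) \<longlongrightarrow> (\<Sum>s'\<in>S - {s}. p s * q s s')) (at_right 0)"
      by (rule tendsto_sum) (use G_rate s in auto)
    ultimately show "((\<lambda>h. \<Sum>s'\<in>S - {s}. G h s' s / h) \<longlongrightarrow> p s * (\<Sum>s'\<in>S - {s}. q s s')) (at_right 0)"
      by (simp add: sum_distrib_left)
  qed simp
  ultimately show ?thesis
    unfolding steady_state_def
    by (auto simp: p_nonneg finite_states has_sum_finite_iff)
qed

section \<open>Symmetry of the two-time laws\<close>

definition asym :: "real \<Rightarrow> real" where
  "asym h = (\<Sum>s\<in>S. \<Sum>u\<in>S. \<bar>G h s u - G h u s\<bar>)"

text \<open>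
  Expanding \<open>G (h + k) s u\<close> through the state at time \<open>h\<close> and \<open>G (k + h) u s\<close> through the state
  at time \<open>k\<close> makes the two factors comparable one by one.
\<close>

lemma asym_add:
  assumes "0 < h" "0 < k"
  shows "asym (h + k) \<le> asym h + asym k"
proof -
  \<comment> \<open>Up to the division by \<open>p m\<close>, this is
    \<open>x * y - x' * y' = (x - x') * y + x' * (y - y')\<close> for the factors of the two
    expansions.\<close>
  have eq: "G (h + k) s u - G (h + k) u s
      = (\<Sum>m\<in>S. (G h s m - G h m s) * (G k m u / p m) + (G h m s / p m) * (G k m u - G k u m))"
    if "s \<in> S" "u \<in> S" for s u
  proof -
    have "G (h + k) u s = (\<Sum>m\<in>S. G k u m * G h m s / p m)"
      using chapman_kolmogorov[OF assms(2,1), of u s] that by (simp add: add.commute)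
    then show ?thesis
      using chapman_kolmogorov[OF assms, of s u] that
      by (simp add: sum_subtractf[symmetric] algebra_simps diff_divide_distrib)
  qed
  have "\<bar>G (h + k) s u - G (h + k) u s\<bar>
      \<le> (\<Sum>m\<in>S. \<bar>G h s m - G h m s\<bar> * (G k m u / p m))
        + (\<Sum>m\<in>S. (G h m s / p m) * \<bar>G k m u - G k u m\<bar>)" if "s \<in> S" "u \<in> S" for s u
    unfolding eq[OF that] sum.distrib[symmetric]
    by (rule order_trans[OF sum_abs], rule sum_mono, rule order_trans[OF abs_triangle_ineq])
       (simp add: abs_mult G_nonneg p_nonneg)
  then have "asym (h + k) \<le> (\<Sum>s\<in>S. \<Sum>u\<in>S. (\<Sum>m\<in>S. \<bar>G h s m - G h m s\<bar> * (G k m u / p m))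
        + (\<Sum>m\<in>S. (G h m s / p m) * \<bar>G k m u - G k u m\<bar>))"
    unfolding asym_def by (intro sum_mono)
  also have "\<dots> = (\<Sum>s\<in>S. \<Sum>u\<in>S. \<Sum>m\<in>S. \<bar>G h s m - G h m s\<bar> * (G k m u / p m))
        + (\<Sum>s\<in>S. \<Sum>u\<in>S. \<Sum>m\<in>S. (G h m s / p m) * \<bar>G k m u - G k u m\<bar>)"
    by (simp add: sum.distrib)
  also have "(\<Sum>s\<in>S. \<Sum>u\<in>S. \<Sum>m\<in>S. \<bar>G h s m - G h m s\<bar> * (G k m u / p m))
      = (\<Sum>s\<in>S. \<Sum>m\<in>S. \<bar>G h s m - G h m s\<bar> * ((\<Sum>u\<in>S. G k m u) / p m))"
    unfolding sum_divide_distrib sum_distrib_left by (rule sum.cong[OF HOL.refl], rule sum.swap)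
  \<comment> \<open>\<open>G_sum_right\<close> makes the weight \<open>p m / p m\<close>, which is
    1, or 0 for a null state.\<close>
  also have "\<dots> \<le> asym h"
    unfolding asym_def by (intro sum_mono) (simp add: G_sum_right)
  also have "(\<Sum>s\<in>S. \<Sum>u\<in>S. \<Sum>m\<in>S. (G h m s / p m) * \<bar>G k m u - G k u m\<bar>)
      = (\<Sum>m\<in>S. \<Sum>u\<in>S. \<Sum>s\<in>S. (G h m s / p m) * \<bar>G k m u - G k u m\<bar>)"
  proof -
    have "(\<Sum>s\<in>S. \<Sum>u\<in>S. \<Sum>m\<in>S. (G h m s / p m) * \<bar>G k m u - G k u m\<bar>)
        = (\<Sum>s\<in>S. \<Sum>m\<in>S. \<Sum>u\<in>S. (G h m s / p m) * \<bar>G k m u - G k u m\<bar>)"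
      by (rule sum.cong[OF HOL.refl], rule sum.swap)
    also have "\<dots> = (\<Sum>m\<in>S. \<Sum>s\<in>S. \<Sum>u\<in>S. (G h m s / p m) * \<bar>G k m u - G k u m\<bar>)"
      by (rule sum.swap)
    also have "\<dots> = (\<Sum>m\<in>S. \<Sum>u\<in>S. \<Sum>s\<in>S. (G h m s / p m) * \<bar>G k m u - G k u m\<bar>)"
      by (rule sum.cong[OF HOL.refl], rule sum.swap)
    finally show ?thesis .
  qed
  also have "\<dots> = (\<Sum>m\<in>S. \<Sum>u\<in>S. ((\<Sum>s\<in>S. G h m s) / p m) * \<bar>G k m u - G k u m\<bar>)"
    unfolding sum_divide_distrib sum_distrib_right ..
  also have "\<dots> \<le> asym k"
    unfolding asym_def by (intro sum_mono) (simp add: G_sum_right)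
  finally show ?thesis by simp
qed

text \<open>Counting from \<open>Suc n\<close> keeps all durations positive, as
  \<open>asym_add\<close> requires.\<close>

lemma asym_mult: "0 < h \<Longrightarrow> asym (real (Suc n) * h) \<le> real (Suc n) * asym h"
proof (induction n)
  case (Suc n)
  have "asym (real (Suc n) * h + h) \<le> asym (real (Suc n) * h) + asym h"
    using Suc.prems by (intro asym_add) auto
  with Suc show ?case by (simp add: algebra_simps)
qed simp

text \<open>Off the diagonal, \<open>G_rate\<close> gives the limit
  \<open>p s * q s u - p u * q u s\<close>, which is 0 by partial balance; diagonal terms are 0
  anyway.\<close>

lemma asym_small:
  assumes "partial_balance S q p"
  shows "((\<lambda>h. asym h / h) \<longlongrightarrow> 0) (at_right 0)"
proof -
  have lim: "((\<lambda>h. \<bar>G h s u / h - G h u s / h\<bar>) \<longlongrightarrow> 0) (at_right 0)" if "s \<in> S" "u \<in> S" for s u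
  proof (cases "s = u")
    case False
    have "((\<lambda>h. \<bar>G h s u / h - G h u s / h\<bar>) \<longlongrightarrow> \<bar>p s * q s u - p u * q u s\<bar>) (at_right 0)"
      using that False by (intro tendsto_intros G_rate) auto
    then show ?thesis using assms that False by (simp add: partial_balance_def)
  qed simp
  have "((\<lambda>h. \<Sum>s\<in>S. \<Sum>u\<in>S. \<bar>G h s u / h - G h u s / h\<bar>) \<longlongrightarrow> (\<Sum>s\<in>S. \<Sum>u\<in>S. 0)) (at_right 0)"
    by (intro tendsto_sum lim)
  then have *: "((\<lambda>h. \<Sum>s\<in>S. \<Sum>u\<in>S. \<bar>G h s u / h - G h u s / h\<bar>) \<longlongrightarrow> 0) (at_right 0)"
    by simp
  show ?thesis
  proof (rule Lim_transform_eventually[OF *])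
    show "\<forall>\<^sub>F h in at_right 0. (\<Sum>s\<in>S. \<Sum>u\<in>S. \<bar>G h s u / h - G h u s / h\<bar>) = asym h / h"
      using eventually_at_right_less[of 0]
    proof eventually_elim
      case (elim h)
      have "\<bar>x / h - y / h\<bar> = \<bar>x - y\<bar> / h" for x y
        using elim by (simp flip: diff_divide_distrib)
      then show ?case by (simp add: asym_def sum_divide_distrib)
    qed
  qed
qed

text \<open>Cutting \<open>h\<close> into \<open>Suc n\<close> equal pieces bounds
  \<open>asym h\<close> by \<open>h\<close> times the value of \<open>asym k / k\<close> at
  \<open>k = h / Suc n\<close>, which tends to 0.\<close>

lemma G_sym:
  assumes "partial_balance S q p" "0 < h" "s \<in> S" "u \<in> S"
  shows "G h s u = G h u s"
proof -
  have "filterlim (\<lambda>n. h / real (Suc n)) (at_right 0) sequentially"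
    unfolding filterlim_at using assms(2)
    using LIMSEQ_Suc[OF lim_const_over_n[of h]] by simp
  then have "(\<lambda>n. asym (h / real (Suc n)) / (h / real (Suc n))) \<longlonglongrightarrow> 0"
    by (rule filterlim_compose[OF asym_small[OF assms(1)]])
  then have "(\<lambda>n. h * (asym (h / real (Suc n)) / (h / real (Suc n)))) \<longlonglongrightarrow> h * 0"
    by (intro tendsto_intros)
  moreover have "asym h \<le> h * (asym (h / real (Suc n)) / (h / real (Suc n)))" for n
    using asym_mult[of "h / real (Suc n)" n] assms(2) by (simp add: field_simps del: of_nat_Suc)
  ultimately have "asym h \<le> 0"
    using LIMSEQ_le_const[of _ "h * 0" "asym h"] by auto
  moreover have "\<bar>G h s u - G h u s\<bar> \<le> asym h"
  proof -
    have "\<bar>G h s u - G h u s\<bar> \<le> (\<Sum>u\<in>S. \<bar>G h s u - G h u s\<bar>)"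
      using assms(4) finite_states by (intro member_le_sum) auto
    also have "\<dots> \<le> asym h"
      unfolding asym_def using assms(3) finite_states
      by (intro member_le_sum[where f = "\<lambda>s. \<Sum>u\<in>S. \<bar>G h s u - G h u s\<bar>"]) (auto intro: sum_nonneg)
    finally show ?thesis .
  qed
  ultimately show ?thesis by simp
qed

section \<open>Path probabilities and their reversal\<close>

text \<open>
  The end points appear as factors \<open>p (x 0)\<close> and \<open>p (x n)\<close> so that the formula is invariant under
  reversing the path.
\<close>

lemma path_prob:
  assumes "strict_mono_on {..n::nat} t" "x ` {..n} \<subseteq> S"
  shows "prob {\<omega> \<in> space M. \<forall>k\<le>n. X (t k) \<omega> = x k} * (\<Prod>k\<le>n. p (x k))
    = p (x 0) * p (x n) * (\<Prod>k<n. G (t (Suc k) - t k) (x k) (x (Suc k)))"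
  using assms
proof (induction n)
  case 0
  then show ?case using prob_X[of "x 0" "t 0"] by simp
next
  case (Suc n)
  let ?P = "\<lambda>n. prob {\<omega> \<in> space M. \<forall>k\<le>n. X (t k) \<omega> = x k}"
  let ?D = "\<Prod>k<n. G (t (Suc k) - t k) (x k) (x (Suc k))"
  let ?g = "G (t (Suc n) - t n) (x n) (x (Suc n))"
  have mono: "strict_mono_on {..n} t" "t n < t (Suc n)"
    using Suc.prems(1) by (auto simp: monotone_on_def)
  have split: "(\<forall>k\<le>Suc n. X (t k) \<omega> = x k)
      \<longleftrightarrow> (\<forall>k\<le>n. X (t k) \<omega> = x k) \<and> X (t (Suc n)) \<omega> = x (Suc n)" for \<omega>
    by (auto simp: le_Suc_eq)
  have IH: "?P n * (\<Prod>k\<le>n. p (x k)) = p (x 0) * p (x n) * ?D"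
    by (rule Suc.IH[OF mono(1)]) (use Suc.prems(2) in auto)
  have step: "?P (Suc n) * p (x n) = ?P n * ?g"
    unfolding split using Suc.prems(2) mono by (intro path_step) auto
  show ?case
  proof (cases "p (x n) = 0")
    case True
    \<comment> \<open>Here \<open>p (x n)\<close> cannot be cancelled; both sides have a zero factor
      instead.\<close>
    have "?g = 0" using G_le[of "t (Suc n) - t n" "x n" "x (Suc n)"] G_nonneg True by (simp add: antisym)
    moreover have "(\<Prod>k\<le>Suc n. p (x k)) = 0" using True by auto
    ultimately show ?thesis by (simp only: prod.lessThan_Suc mult_zero_right)
  next
    case False
    \<comment> \<open>The additional factor \<open>p (x n)\<close> makes \<open>path_step\<close>
      applicable; it is cancelled at the end.\<close>
    have "?P (Suc n) * (\<Prod>k\<le>Suc n. p (x k)) * p (x n)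
        = (?P (Suc n) * p (x n)) * (\<Prod>k\<le>n. p (x k)) * p (x (Suc n))"
      by (simp add: ac_simps)
    also have "\<dots> = (?P n * (\<Prod>k\<le>n. p (x k))) * ?g * p (x (Suc n))"
      unfolding step by (simp only: ac_simps)
    also have "\<dots> = (p (x 0) * p (x (Suc n)) * (?D * ?g)) * p (x n)"
      unfolding IH by (simp only: ac_simps)
    finally show ?thesis by (simp only: prod.lessThan_Suc mult_right_cancel[OF False])
  qed
qed

text \<open>A path through a null state is a null event; \<open>path_reverse\<close> needs this
  where the product of the \<open>p (x k)\<close> cannot be cancelled.\<close>

lemma path_le: "k \<le> n \<Longrightarrow> x k \<in> S \<Longrightarrow> prob {\<omega> \<in> space M. \<forall>k\<le>n. X (t k) \<omega> = x k} \<le> p (x k)"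
  unfolding prob_X[of "x k" "t k", symmetric] by (rule finite_measure_mono) auto

lemma path_reverse:
  assumes bal: "partial_balance S q p" and mono: "strict_mono_on {..n::nat} t" and x: "x ` {..n} \<subseteq> S"
  shows "prob {\<omega> \<in> space M. \<forall>k\<le>n. X (t' - t k) \<omega> = x k} = prob {\<omega> \<in> space M. \<forall>k\<le>n. X (t k) \<omega> = x k}"
proof -
  \<comment> \<open>The times \<open>t' - t k\<close> decrease with \<open>k\<close>, so the path is
    listed backwards to obtain increasing times.\<close>
  define u y where "u j = t' - t (n - j)" and "y j = x (n - j)" for j
  let ?A = "prob {\<omega> \<in> space M. \<forall>k\<le>n. X (t k) \<omega> = x k}"
  let ?B = "prob {\<omega> \<in> space M. \<forall>k\<le>n. X (u k) \<omega> = y k}"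
  have rev: "(\<forall>k\<le>n. X (t' - t k) \<omega> = x k) \<longleftrightarrow> (\<forall>k\<le>n. X (u k) \<omega> = y k)" for \<omega>
    unfolding u_def y_def by (metis diff_diff_cancel diff_le_self)
  have u: "strict_mono_on {..n} u"
    using mono unfolding u_def monotone_on_def by (auto simp: diff_less_mono2)
  have y: "y ` {..n} \<subseteq> S" using x by (auto simp: y_def)
  have prods: "(\<Prod>k\<le>n. p (y k)) = (\<Prod>k\<le>n. p (x k))"
    unfolding y_def by (rule prod.reindex_bij_witness[of _ "\<lambda>k. n - k" "\<lambda>k. n - k"]) auto
  have "(\<Prod>k<n. G (u (Suc k) - u k) (y k) (y (Suc k)))
      = (\<Prod>k<n. G (t (Suc k) - t k) (x k) (x (Suc k)))"
  proof (rule prod.reindex_bij_witness[of _ "\<lambda>k. n - Suc k" "\<lambda>k. n - Suc k"])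
    fix k assume "k \<in> {..<n}"
    then have k: "k < n" "n - k = Suc (n - Suc k)" by auto
    then have "t (n - Suc k) < t (Suc (n - Suc k))" "x (n - Suc k) \<in> S" "x (Suc (n - Suc k)) \<in> S"
      using mono x by (auto simp: monotone_on_def)
    \<comment> \<open>Factor \<open>k\<close> of the reversed path is factor
      \<open>n - Suc k\<close> of the original one with its end points exchanged, which
      \<open>G_sym\<close> allows.\<close>
    then show "G (t (Suc (n - Suc k)) - t (n - Suc k)) (x (n - Suc k)) (x (Suc (n - Suc k)))
        = G (u (Suc k) - u k) (y k) (y (Suc k))"
      using G_sym[OF bal] k(2) by (simp add: u_def y_def)
  qed auto
  then have eq: "?A * (\<Prod>k\<le>n. p (x k)) = ?B * (\<Prod>k\<le>n. p (x k))"
    using path_prob[OF mono x] path_prob[OF u y] prods by (simp add: y_def)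
  have "?A = ?B"
  proof (cases "(\<Prod>k\<le>n. p (x k)) = 0")
    case True
    then obtain k where k: "k \<le> n" "p (x k) = 0" by auto
    have "?A \<le> 0" using path_le[of k n x t] k x by auto
    moreover have "?B \<le> 0" using path_le[of "n - k" n y u] k x by (auto simp: y_def)
    ultimately show ?thesis by (simp add: measure_le_0_iff)
  qed (use eq in simp)
  then show ?thesis by (simp add: rev)
qed

theorem time_reversible:
  assumes "partial_balance S q p"
  shows "time_reversible M X S"
  unfolding time_reversible_def
proof (intro allI impI)
  fix n :: nat and t :: "nat \<Rightarrow> real" and t'
  assume "1 \<le> n" and mono: "strict_mono_on {..<n} t"
  then obtain m where n: "n = Suc m" by (cases n) auto
  show "joint M X S n t = joint M X S n (\<lambda>k. t' - t k)"
  proof (rule joint_eqI)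
    fix x assume x: "x \<in> PiE {..<n} (\<lambda>_. S)"
    have 1: "x ` {..m} \<subseteq> S" using PiE_mem[OF x] by (auto simp: n)
    have 2: "strict_mono_on {..m} t" using mono by (simp only: n lessThan_Suc_atMost)
    show "prob {\<omega> \<in> space M. \<forall>k<n. X (t k) \<omega> = x k}
        = prob {\<omega> \<in> space M. \<forall>k<n. X (t' - t k) \<omega> = x k}"
      unfolding n less_Suc_eq_le by (rule path_reverse[OF assms 2 1, symmetric])
  qed
qed

end

section \<open>Finite chains with symmetric rates\<close>

lemma symmetric_steady_uniform:
  assumes fin: "finite S" and sym: "\<And>s u. s \<in> S \<Longrightarrow> u \<in> S \<Longrightarrow> q s u = q u s"
    and nonneg: "\<And>s u. 0 \<le> q s u"
    and conn: "\<And>A. A \<subseteq> S \<Longrightarrow> A \<noteq> {} \<Longrightarrow> (\<And>s u. s \<in> A \<Longrightarrow> u \<in> S \<Longrightarrow> 0 < q s u \<Longrightarrow> u \<in> A) \<Longrightarrow> A = S"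
    and steady: "steady_state S q \<pi>"
  shows "\<pi> = (\<lambda>s. if s \<in> S then 1 / real (card S) else 0)"
proof -
  have total: "sum \<pi> S = 1"
    using steady fin by (simp add: steady_state_def has_sum_finite_iff)
  then have ne: "S \<noteq> {}" by auto
  \<comment> \<open>Maximum principle: the maximisers are closed under transitions of positive rate,
    so \<open>conn\<close> makes them all of \<open>S\<close>.\<close>
  define m where "m = Max (\<pi> ` S)"
  define A where "A = {s \<in> S. \<pi> s = m}"
  have "m \<in> \<pi> ` S" unfolding m_def using fin ne by simp
  then have A_ne: "A \<noteq> {}" by (auto simp: A_def)
  have A_closed: "u \<in> A" if "s \<in> A" "u \<in> S" "0 < q s u" for s u
  proof (cases "u = s")
    case False
    have s: "s \<in> S" using that by (simp add: A_def)
    have le: "\<pi> v \<le> \<pi> s" if "v \<in> S" for v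
      using \<open>s \<in> A\<close> fin that by (simp add: A_def m_def)
    have "(\<Sum>v\<in>S - {s}. \<pi> v * q v s) = \<pi> s * (\<Sum>v\<in>S - {s}. q s v)"
      using steady s fin by (simp add: steady_state_def has_sum_finite_iff)
    moreover have "(\<Sum>v\<in>S - {s}. \<pi> v * q v s) = (\<Sum>v\<in>S - {s}. \<pi> v * q s v)"
      using sym s by (intro sum.cong) auto
    \<comment> \<open>By symmetry, global balance at a maximiser says that a sum of nonnegative
      terms is 0.\<close>
    ultimately have "(\<Sum>v\<in>S - {s}. (\<pi> s - \<pi> v) * q s v) = 0"
      by (simp add: left_diff_distrib sum_subtractf sum_distrib_left)
    then have "(\<pi> s - \<pi> u) * q s u = 0"
      using that False
      by (intro sum_nonneg_0[where f = "\<lambda>v. (\<pi> s - \<pi> v) * q s v" and s = "S - {s}"])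
         (auto simp: fin le nonneg)
    then show ?thesis using that by (simp add: A_def)
  qed (use that in simp)
  have "A \<subseteq> S" unfolding A_def by (rule Collect_restrict)
  then have "A = S" using A_ne A_closed by (rule conn)
  then have const: "\<pi> s = m" if "s \<in> S" for s
    using that unfolding A_def by blast
  then have "real (card S) * m = 1" using total by simp
  then have "m = 1 / real (card S)" using ne fin by (simp add: field_simps)
  then show ?thesis using const steady by (auto simp: steady_state_def)
qed

lemma symmetric_uniform_steady:
  assumes "finite S" "S \<noteq> {}" and sym: "\<And>s u. s \<in> S \<Longrightarrow> u \<in> S \<Longrightarrow> q s u = q u s"
  shows "steady_state S q (\<lambda>s. if s \<in> S then 1 / real (card S) else 0)"
  using assms unfolding steady_state_def
  by (auto simp: has_sum_finite_iff sum_distrib_left intro!: sum.cong)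

lemma symmetric_ctmc_time_reversible:
  assumes "finite S" "S \<noteq> {}" and sym: "\<And>s u. s \<in> S \<Longrightarrow> u \<in> S \<Longrightarrow> q s u = q u s"
    and nonneg: "\<And>s u. 0 \<le> q s u"
    and conn: "\<And>A. A \<subseteq> S \<Longrightarrow> A \<noteq> {} \<Longrightarrow> (\<And>s u. s \<in> A \<Longrightarrow> u \<in> S \<Longrightarrow> 0 < q s u \<Longrightarrow> u \<in> A) \<Longrightarrow> A = S"
  shows "ctmc_time_reversible S q"
proof -
  have unif: "\<pi> = (\<lambda>s. if s \<in> S then 1 / real (card S) else 0)" if "steady_state S q \<pi>" for \<pi>
    using assms(1) sym nonneg conn that by (rule symmetric_steady_uniform)
  have bal: "partial_balance S q \<pi>" if "steady_state S q \<pi>" for \<pi>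
    using unif[OF that] sym by (simp add: partial_balance_def)
  have "time_reversible M (\<lambda>t \<omega>. \<omega> t) S" if "stationary_ctmc M (\<lambda>t \<omega>. \<omega> t) S q" for M
  proof -
    interpret prob_space M using that by (simp add: stationary_ctmc_def)
    interpret finite_stationary_ctmc M "\<lambda>t \<omega>. \<omega> t" S q
      using that assms(1) by unfold_locales auto
    \<comment> \<open>The law at time 0 of a stationary version is a steady state, hence uniform and
      in partial balance.\<close>
    show ?thesis by (rule time_reversible[OF bal[OF p_steady]])
  qed
  moreover have "\<exists>!\<pi>. steady_state S q \<pi>"
    using symmetric_uniform_steady[OF assms(1,2), of q] sym unif by blast
  ultimately show ?thesis using bal by (simp add: ctmc_time_reversible_def)
qed

section \<open>Reversibility and finiteness of the process semantics\<close>

lemma rate_val_pos: "0 < rate_val l"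
  using rate_val[of l] by simp

text \<open>Every forward rule has a backward counterpart with the same side conditions; equal rates
  make the labels agree as well.\<close>

lemma loop_lemma:
  assumes "\<forall>l. bk l = l"
  shows "bstep bk T a r i T' \<longleftrightarrow> fstep T' a r i T"
proof
  show "bstep bk T a r i T' \<Longrightarrow> fstep T' a r i T"
    by (induction rule: bstep.induct) (auto simp: assms intro: fstep.intros)
  show "fstep T' a r i T \<Longrightarrow> bstep bk T a r i T'"
  proof (induction rule: fstep.induct)
    case (Act1 R a l i)
    then show ?case by (metis assms bstep.Act1r)
  qed (auto intro: bstep.intros)
qed

section \<open>Erasure of keys\<close>

lemma keys_std: "std T \<Longrightarrow> keys T = {}"
  by (induction T) auto

lemma finite_keys: "finite (keys T)"
  by (induction T) auto

text \<open>An invariant of the transitions and of the key equivalence: executed prefixes are turned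
  back into unexecuted ones.\<close>

primrec skel :: "('a, 'k) proc \<Rightarrow> ('a, 'k) proc" where
  "skel Stop = Stop"
| "skel (Pre a l R) = Pre a l (skel R)"
| "skel (Past a l i R) = Pre a l (skel R)"
| "skel (Choice R S) = Choice (skel R) (skel S)"
| "skel (Par R L S) = Par (skel R) L (skel S)"

lemma skel_fill: "skel T = skel T' \<Longrightarrow> skel (fill C T) = skel (fill C T')"
  by (induction C) auto

lemma skel_fstep: "fstep T a r i T' \<Longrightarrow> skel T' = skel T"
  by (induction rule: fstep.induct) auto

lemma skel_sync_ren: "sync_ren a i j n T T' \<Longrightarrow> skel T' = skel T"
  by (induction rule: sync_ren.induct) (auto intro!: skel_fill)

lemma skel_key_equiv: "T \<equiv>\<^sub>K T' \<Longrightarrow> skel T' = skel T"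
  by (induction rule: key_equiv.induct) (auto simp: skel_sync_ren intro!: skel_fill)

text \<open>Each key marks at least one executed prefix, and the skeleton retains all
  prefixes.\<close>

lemma card_keys_le: "card (keys T) \<le> size (skel T)"
proof (induction T)
  case (Past a l i R)
  then show ?case using card_insert_le_m1 by (simp add: card_insert_if finite_keys)
next
  case (Choice R S)
  then show ?case using card_Un_le[of "keys R" "keys S"] by simp
next
  case (Par R L S)
  then show ?case using card_Un_le[of "keys R" "keys S"] by simp
qed auto

text \<open>A process is recovered from its skeleton by choosing the executed prefixes and their
  keys.\<close>

lemma finite_skel_keys:
  assumes "finite F"
  shows "finite {T. skel T = P \<and> keys T \<subseteq> F}"
proof (induction P)
  case Stop
  have "{T. skel T = Stop \<and> keys T \<subseteq> F} \<subseteq> {Stop}"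
  proof
    fix T assume "T \<in> {T. skel T = Stop \<and> keys T \<subseteq> F}"
    then show "T \<in> {Stop}" by (cases T) auto
  qed
  then show ?case by (rule finite_subset) simp
next
  case (Pre a l P)
  let ?X = "{T. skel T = P \<and> keys T \<subseteq> F}"
  have "{T. skel T = Pre a l P \<and> keys T \<subseteq> F} \<subseteq> Pre a l ` ?X \<union> (\<lambda>(i, R). Past a l i R) ` (F \<times> ?X)"
  proof
    fix T assume "T \<in> {T. skel T = Pre a l P \<and> keys T \<subseteq> F}"
    then show "T \<in> Pre a l ` ?X \<union> (\<lambda>(i, R). Past a l i R) ` (F \<times> ?X)"
      by (cases T) auto
  qed
  then show ?case by (rule finite_subset) (use Pre assms in auto)
next
  case (Past a l i P)
  have "skel T \<noteq> Past a l i P" for T by (cases T) auto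
  then show ?case by simp
next
  case (Choice P Q)
  let ?X = "\<lambda>P. {T. skel T = P \<and> keys T \<subseteq> F}"
  have "{T. skel T = Choice P Q \<and> keys T \<subseteq> F} \<subseteq> (\<lambda>(R, S). Choice R S) ` (?X P \<times> ?X Q)"
  proof
    fix T assume "T \<in> {T. skel T = Choice P Q \<and> keys T \<subseteq> F}"
    then show "T \<in> (\<lambda>(R, S). Choice R S) ` (?X P \<times> ?X Q)"
      by (cases T) auto
  qed
  then show ?case by (rule finite_subset) (use Choice in auto)
next
  case (Par P L Q)
  let ?X = "\<lambda>P. {T. skel T = P \<and> keys T \<subseteq> F}"
  have "{T. skel T = Par P L Q \<and> keys T \<subseteq> F} \<subseteq> (\<lambda>(R, S). Par R L S) ` (?X P \<times> ?X Q)"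
  proof
    fix T assume "T \<in> {T. skel T = Par P L Q \<and> keys T \<subseteq> F}"
    then show "T \<in> (\<lambda>(R, S). Par R L S) ` (?X P \<times> ?X Q)"
      by (cases T) auto
  qed
  then show ?case by (rule finite_subset) (use Par in auto)
qed

section \<open>Transition labels\<close>

text \<open>An over-approximation of the labels that any execution can produce.\<close>

primrec labels :: "('a, 'k) proc \<Rightarrow> ('a \<times> real) set" where
  "labels Stop = {}"
| "labels (Pre a l R) = insert (a, rate_val l) (labels R)"
| "labels (Past a l i R) = insert (a, rate_val l) (labels R)"
| "labels (Choice R S) = labels R \<union> labels S"
| "labels (Par R L S) = labels R \<union> labels S
     \<union> (\<lambda>((a, r), (b, u)). (a, r * u)) ` (labels R \<times> labels S)"

lemma finite_labels: "finite (labels T)"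
  by (induction T) auto

text \<open>Processes with the same skeleton share one label set; in particular, all members of a
  key class do.\<close>

lemma labels_skel: "labels (skel T) = labels T"
  by (induction T) auto

lemma fstep_labels: "fstep T a r i T' \<Longrightarrow> (a, r) \<in> labels T"
  by (induction rule: fstep.induct) (auto simp: image_iff, force)

lemma fstep_pos: "fstep T a r i T' \<Longrightarrow> 0 < r"
  by (induction rule: fstep.induct) (auto simp: rate_val_pos)

section \<open>Executions that share a key\<close>

text \<open>\<open>synced a i T\<close>: all occurrences of the key \<open>i\<close> in \<open>T\<close> stem from one execution of \<open>a\<close>.\<close>

primrec synced :: "'a \<Rightarrow> 'k \<Rightarrow> ('a, 'k) proc \<Rightarrow> bool" where
  "synced a i Stop \<longleftrightarrow> False"
| "synced a i (Pre b l R) \<longleftrightarrow> False"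
| "synced a i (Past b l k R) \<longleftrightarrow> (if k = i then b = a \<and> i \<notin> keys R else synced a i R)"
| "synced a i (Choice R S) \<longleftrightarrow> synced a i R \<and> i \<notin> keys S \<or> i \<notin> keys R \<and> synced a i S"
| "synced a i (Par R L S) \<longleftrightarrow> (if a \<in> L then synced a i R \<and> synced a i S
     else synced a i R \<and> i \<notin> keys S \<or> i \<notin> keys R \<and> synced a i S)"

lemma fstep_keys: "fstep T a r k T' \<Longrightarrow> k \<notin> keys T \<and> keys T' = insert k (keys T)"
  by (induction rule: fstep.induct) (auto simp: keys_std)

lemma fstep_synced_new: "fstep T a r k T' \<Longrightarrow> synced a k T'"
  by (induction rule: fstep.induct) (auto simp: keys_std)

lemma fstep_synced: "fstep T b r k T' \<Longrightarrow> i \<noteq> k \<Longrightarrow> synced a i T \<Longrightarrow> synced a i T'"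
  by (induction rule: fstep.induct) (auto simp: keys_std fstep_keys split: if_splits)

text \<open>The transition that introduces a key makes it synced; every later one has a fresh key by
  \<open>fstep_keys\<close> and preserves this by \<open>fstep_synced\<close>.\<close>

lemma reachable_synced: "T \<in> reachable \<Longrightarrow> i \<in> keys T \<Longrightarrow> \<exists>a. synced a i T"
proof (induction rule: reachable.induct)
  case (base P)
  then show ?case by (simp add: keys_std)
next
  case (step R a r k R')
  show ?case
  proof (cases "i = k")
    case True
    then show ?thesis using fstep_synced_new[OF step.hyps(2)] by auto
  next
    case False
    then show ?thesis
      using step fstep_keys[OF step.hyps(2)] fstep_synced[OF step.hyps(2)] by blast
  qed
qed

section \<open>Renaming one key inside a context\<close>

primrec ccomp :: "('a, 'k) ctx \<Rightarrow> ('a, 'k) ctx \<Rightarrow> ('a, 'k) ctx" where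
  "ccomp Hole D = D"
| "ccomp (CPast a l i C) D = CPast a l i (ccomp C D)"
| "ccomp (CChoR R C) D = CChoR R (ccomp C D)"
| "ccomp (CChoL C R) D = CChoL (ccomp C D) R"
| "ccomp (CParR R L C) D = CParR R L (ccomp C D)"
| "ccomp (CParL C L R) D = CParL (ccomp C D) L R"

lemma fill_ccomp [simp]: "fill (ccomp C D) T = fill C (fill D T)"
  by (induction C) auto

lemma ckeys_ccomp [simp]: "ckeys (ccomp C D) = ckeys C \<union> ckeys D"
  by (induction C) auto

lemma csyncs_ccomp [simp]: "csyncs (ccomp C D) = csyncs C \<union> csyncs D"
  by (induction C) auto

text \<open>The surrounding context is merged with the outermost context of \<open>leaf\<close> or
  \<open>node\<close>, so a case distinction suffices.\<close>

lemma sync_ren_fill: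
  assumes "sync_ren a i j n T T'" "i \<notin> ckeys D" "j \<notin> ckeys D"
  shows "sync_ren a i j n (fill D T) (fill D T')"
  using assms(1)
proof cases
  case (leaf C R l)
  then show ?thesis
    using sync_ren.leaf[of i "ccomp D C" R j a l] assms(2,3) by simp
next
  case (node m T1 T1' n' U U' L C)
  then show ?thesis
    using sync_ren.node[of a i j m T1 T1' n' U U' L "ccomp D C"] assms(2,3) by simp
qed

text \<open>
  One step of one of the two generating clauses of \<open>key_equiv\<close>, without the reachability
  conditions.
\<close>

definition key_ren :: "'a \<Rightarrow> 'k \<Rightarrow> 'k \<Rightarrow> ('a, 'k) proc \<Rightarrow> ('a, 'k) proc \<Rightarrow> bool" where
  "key_ren a i j T T' \<longleftrightarrow> (\<exists>n\<ge>2. sync_ren a i j n T T') \<or>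
     (\<exists>C l R. T = fill C (Past a l i R) \<and> T' = fill C (Past a l j R) \<and> (\<forall>L\<in>csyncs C. a \<notin> L)
        \<and> i \<notin> ckeys C \<union> keys R \<and> j \<notin> ckeys C \<union> keys R)"

lemma key_ren_fill:
  assumes "key_ren a i j T T'" "i \<notin> ckeys D" "j \<notin> ckeys D" "\<forall>L\<in>csyncs D. a \<notin> L"
  shows "key_ren a i j (fill D T) (fill D T')"
  using assms(1) unfolding key_ren_def
proof (elim disjE exE conjE)
  fix n assume "n \<ge> 2" "sync_ren a i j n T T'"
  then show "(\<exists>n\<ge>2. sync_ren a i j n (fill D T) (fill D T')) \<or>
     (\<exists>C l R. fill D T = fill C (Past a l i R) \<and> fill D T' = fill C (Past a l j R)
        \<and> (\<forall>L\<in>csyncs C. a \<notin> L) \<and> i \<notin> ckeys C \<union> keys R \<and> j \<notin> ckeys C \<union> keys R)"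
    by (intro disjI1 exI[of _ n] conjI sync_ren_fill assms(2,3))
next
  fix C l R
  assume *: "T = fill C (Past a l i R)" "T' = fill C (Past a l j R)" "\<forall>L\<in>csyncs C. a \<notin> L"
    "i \<notin> ckeys C \<union> keys R" "j \<notin> ckeys C \<union> keys R"
  show "(\<exists>n\<ge>2. sync_ren a i j n (fill D T) (fill D T')) \<or>
     (\<exists>C l R. fill D T = fill C (Past a l i R) \<and> fill D T' = fill C (Past a l j R)
        \<and> (\<forall>L\<in>csyncs C. a \<notin> L) \<and> i \<notin> ckeys C \<union> keys R \<and> j \<notin> ckeys C \<union> keys R)"
    by (rule disjI2, rule exI[of _ "ccomp D C"], rule exI[of _ l], rule exI[of _ R])
       (use * assms in auto)
qed

text \<open>A single renamed prefix is a \<open>leaf\<close>; thus both kinds of renaming can serve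
  as branches of a \<open>node\<close>.\<close>

lemma key_ren_sync_ren: "key_ren a i j T T' \<Longrightarrow> \<exists>n>0. sync_ren a i j n T T'"
  unfolding key_ren_def
proof (elim disjE exE conjE)
  fix C l R assume "T = fill C (Past a l i R)" "T' = fill C (Past a l j R)"
    "i \<notin> ckeys C \<union> keys R" "j \<notin> ckeys C \<union> keys R"
  then have "sync_ren a i j 1 T T'" using sync_ren.leaf[of i C R j a l] by simp
  then show ?thesis by (intro exI[of _ 1]) simp
next
  fix n :: nat assume "n \<ge> 2" "sync_ren a i j n T T'"
  then show ?thesis by (intro exI[of _ n]) simp
qed

text \<open>Each side contributes at least one prefix, which yields the two prefixes that the
  synchronised clause demands.\<close>

lemma key_ren_Par_sync:
  assumes "key_ren a i j T T'" "key_ren a i j U U'" "a \<in> L"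
  shows "key_ren a i j (Par T L U) (Par T' L U')"
proof -
  obtain m n where "m > 0" "n > 0" "sync_ren a i j m T T'" "sync_ren a i j n U U'"
    using key_ren_sync_ren assms by metis
  then have "sync_ren a i j (m + n) (Par T L U) (Par T' L U')" "m + n \<ge> 2"
    using sync_ren.node[of a i j m T T' n U U' L Hole] assms(3) by auto
  then show ?thesis unfolding key_ren_def by blast
qed

section \<open>Injective renaming of keys\<close>

lemma keys_map_proc: "keys (map_proc f T) = f ` keys T"
  by (induction T) auto

lemma std_map_proc: "std (map_proc f T) = std T"
  by (induction T) auto

lemma map_proc_transpose_fresh:
  "i \<notin> keys T \<Longrightarrow> j \<notin> keys T \<Longrightarrow> map_proc (Transposition.transpose i j) T = T"
  by (induction T) (auto simp: Transposition.transpose_def)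

text \<open>Under a synchronising operator the two renamings are joined by
  \<open>key_ren_Par_sync\<close>; at a choice or an unsynchronised operator the key lies on one
  side and the other side joins the context. A transposition is used because injective maps preserve
  reachability.\<close>

lemma synced_key_ren:
  "synced a i T \<Longrightarrow> j \<notin> keys T \<Longrightarrow> key_ren a i j T (map_proc (Transposition.transpose i j) T)"
proof (induction T)
  case (Past b l k R)
  show ?case
  proof (cases "k = i")
    case True
    have "key_ren a i j (fill Hole (Past a l i R)) (fill Hole (Past a l j R))"
      unfolding key_ren_def using Past.prems True
      by (intro disjI2 exI[of _ Hole] exI[of _ l] exI[of _ R]) auto
    then show ?thesis using Past.prems True by (simp add: map_proc_transpose_fresh)
  next
    case False
    then show ?thesis
      using Past key_ren_fill[of a i j R "map_proc (Transposition.transpose i j) R" "CPast b l k Hole"]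
      by auto
  qed
next
  case (Choice R S)
  consider "synced a i R" "i \<notin> keys S" | "synced a i S" "i \<notin> keys R"
    using Choice.prems by auto
  then show ?case
  proof cases
    case 1
    then show ?thesis
      using key_ren_fill[OF Choice.IH(1), of "CChoL Hole S"] Choice.prems(2)
      by (simp add: map_proc_transpose_fresh)
  next
    case 2
    then show ?thesis
      using key_ren_fill[OF Choice.IH(2), of "CChoR R Hole"] Choice.prems(2)
      by (simp add: map_proc_transpose_fresh)
  qed
next
  case (Par R L S)
  consider "synced a i R" "synced a i S" "a \<in> L" | "synced a i R" "i \<notin> keys S" "a \<notin> L"
    | "synced a i S" "i \<notin> keys R" "a \<notin> L"
    using Par.prems(1) by (auto split: if_splits)
  then show ?case
  proof cases
    case 1
    then show ?thesis
      using key_ren_Par_sync[OF Par.IH(1) Par.IH(2)] Par.prems(2) by simp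
  next
    case 2
    then show ?thesis
      using key_ren_fill[OF Par.IH(1), of "CParL Hole L S"] Par.prems(2)
      by (simp add: map_proc_transpose_fresh)
  next
    case 3
    then show ?thesis
      using key_ren_fill[OF Par.IH(2), of "CParR R L Hole"] Par.prems(2)
      by (simp add: map_proc_transpose_fresh)
  qed
qed auto

text \<open>Injectivity preserves the freshness conditions of the rules.\<close>

lemma fstep_map_proc:
  "fstep T a r k T' \<Longrightarrow> inj f \<Longrightarrow> fstep (map_proc f T) a r (f k) (map_proc f T')"
  by (induction rule: fstep.induct)
     (auto intro!: fstep.intros simp: std_map_proc keys_map_proc inj_image_mem_iff inj_eq)

lemma reachable_map_proc: "T \<in> reachable \<Longrightarrow> inj f \<Longrightarrow> map_proc f T \<in> reachable"
  by (induction rule: reachable.induct)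
     (auto intro: reachable.intros fstep_map_proc simp: std_map_proc)

lemma key_equiv_transpose:
  assumes "T \<in> reachable" "i \<in> keys T" "j \<notin> keys T"
  shows "T \<equiv>\<^sub>K map_proc (Transposition.transpose i j) T"
proof -
  obtain a where "synced a i T" using reachable_synced[OF assms(1,2)] by blast
  then have "key_ren a i j T (map_proc (Transposition.transpose i j) T)"
    using assms(3) by (rule synced_key_ren)
  moreover have "map_proc (Transposition.transpose i j) T \<in> reachable"
    using assms(1) by (rule reachable_map_proc) (simp add: bij_is_inj)
  ultimately show ?thesis
    using assms(1) unfolding key_ren_def by (metis key_equiv.single key_equiv.sync)
qed

section \<open>Finitely many key classes\<close>

lemma key_equiv_reachable: "T \<equiv>\<^sub>K T' \<Longrightarrow> T \<in> reachable \<and> T' \<in> reachable"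
  by (induction rule: key_equiv.induct) auto

lemma rename_into:
  assumes "finite F" "F = UNIV \<or> size P \<le> card F"
  shows "T \<in> reachable \<Longrightarrow> skel T = P \<Longrightarrow> \<exists>T'. T \<equiv>\<^sub>K T' \<and> keys T' \<subseteq> F"
proof (induction "card (keys T - F)" arbitrary: T rule: less_induct)
  case less
  show ?case
  proof (cases "keys T \<subseteq> F")
    case True
    then show ?thesis using key_equiv.refl less.prems by blast
  next
    case False
    then obtain i where i: "i \<in> keys T" "i \<notin> F" by auto
    \<comment> \<open>Otherwise \<open>T\<close>, with \<open>i\<close> besides all of
      \<open>F\<close>, would exceed the bound of \<open>card_keys_le\<close>;
      \<open>F = UNIV\<close> contradicts the choice of \<open>i\<close>.\<close>
    have "\<not> F \<subseteq> keys T"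
    proof
      assume "F \<subseteq> keys T"
      then have "card F < card (keys T)"
        using i by (intro psubset_card_mono finite_keys) auto
      then show False using card_keys_le[of T] assms(2) i(2) less.prems(2) by auto
    qed
    then obtain j where j: "j \<in> F" "j \<notin> keys T" by auto
    let ?T = "map_proc (Transposition.transpose i j) T"
    have eq: "T \<equiv>\<^sub>K ?T" using less.prems(1) i(1) j(2) by (rule key_equiv_transpose)
    have "keys ?T - F \<subset> keys T - F"
      using i j by (auto simp: keys_map_proc Transposition.transpose_def)
    then have "card (keys ?T - F) < card (keys T - F)"
      by (intro psubset_card_mono) (auto simp: finite_keys)
    then obtain T' where "?T \<equiv>\<^sub>K T'" "keys T' \<subseteq> F"
      using less.hyps[of ?T] key_equiv_reachable[OF eq] skel_key_equiv[OF eq] less.prems(2) by metis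
    then show ?thesis using key_equiv.trans[OF eq] by metis
  qed
qed

lemma key_class_eq: "T \<equiv>\<^sub>K T' \<Longrightarrow> key_class T = key_class T'"
  unfolding key_class_def by (auto intro: key_equiv.sym key_equiv.trans)

lemma key_class_eqD: "T' \<in> reachable \<Longrightarrow> key_class T = key_class T' \<Longrightarrow> T \<equiv>\<^sub>K T'"
  unfolding key_class_def using key_equiv.refl by blast

text \<open>Every such class has a representative with keys in one fixed finite set
  \<open>F\<close>, and \<open>finite_skel_keys\<close> bounds these.\<close>

lemma finite_key_classes: "finite (key_class ` {T \<in> reachable. skel T = (P :: ('a, 'k) proc)})"
proof -
  have "\<exists>F :: 'k set. finite F \<and> (F = UNIV \<or> size P \<le> card F)"
  proof (cases "finite (UNIV :: 'k set)")
    case False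
    then show ?thesis using infinite_arbitrarily_large[of "UNIV :: 'k set" "size P"] by (metis order_refl)
  qed (rule exI[of _ UNIV], simp)
  then obtain F :: "'k set" where F: "finite F" "F = UNIV \<or> size P \<le> card F" by (elim exE conjE)
  have "key_class ` {T \<in> reachable. skel T = P} \<subseteq> key_class ` {T. skel T = P \<and> keys T \<subseteq> F}"
  proof
    fix s assume "s \<in> key_class ` {T \<in> reachable. skel T = P}"
    then obtain T where T: "T \<in> reachable" "skel T = P" "s = key_class T" by auto
    then obtain T' where "T \<equiv>\<^sub>K T'" "keys T' \<subseteq> F" using rename_into[OF F] by metis
    then have "s = key_class T'" "skel T' = P" "keys T' \<subseteq> F"
      using T key_class_eq skel_key_equiv by metis+
    then show "s \<in> key_class ` {T. skel T = P \<and> keys T \<subseteq> F}" by simp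
  qed
  then show ?thesis by (rule finite_subset) (simp add: finite_skel_keys F(1))
qed

section \<open>States and rates of the underlying chain\<close>

lemma btrans_ftrans: "\<forall>l. bk l = l \<Longrightarrow> btrans bk s a r s' \<longleftrightarrow> ftrans s' a r s"
  unfolding btrans_def ftrans_def by (auto simp: loop_lemma)

lemma ftrans_pos: "ftrans s a r s' \<Longrightarrow> 0 < r"
  by (auto simp: ftrans_def fstep_pos)

text \<open>Members of the source class share one finite label set, so the infinite sums in
  \<open>ctmc_rate\<close> reduce to finite ones.\<close>

lemma finite_ftrans: "finite {(a, r). ftrans s a r s'}"
proof (cases "\<exists>T \<in> reachable. s = key_class T")
  case True
  then obtain T where T: "T \<in> reachable" "s = key_class T" by blast
  have "(a, r) \<in> labels T" if "ftrans s a r s'" for a r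
  proof -
    obtain U U' i where U: "U \<in> reachable" "s = key_class U" "fstep U a r i U'"
      using \<open>ftrans s a r s'\<close> unfolding ftrans_def by blast
    then have "skel U = skel T"
      using key_class_eqD[of U T] T skel_key_equiv by metis
    then show ?thesis using fstep_labels[OF U(3)] labels_skel by metis
  qed
  then have "{(a, r). ftrans s a r s'} \<subseteq> labels T" by auto
  then show ?thesis by (rule finite_subset) (rule finite_labels)
qed (auto simp: ftrans_def)

lemma ctmc_states_skel:
  assumes "\<forall>l. bk l = l" "R \<in> reachable"
  shows "s \<in> ctmc_states bk R \<Longrightarrow> s \<in> key_class ` {T \<in> reachable. skel T = skel R}"
proof (induction rule: ctmc_states.induct)
  case init
  then show ?case using assms(2) by blast
next
  case (fwd s a r s')
  then obtain T U U' i where "T \<in> reachable" "skel T = skel R" "s = key_class T" "U \<in> reachable"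
      "s = key_class U" "fstep U a r i U'" "U' \<in> reachable" "s' = key_class U'"
    unfolding ftrans_def by blast
  moreover from this have "skel U' = skel R"
    using key_class_eqD[of U T] skel_key_equiv skel_fstep by metis
  ultimately show ?case by blast
next
  case (bwd s a r s')
  then obtain T U U' i where "T \<in> reachable" "skel T = skel R" "s = key_class T" "U \<in> reachable"
      "s = key_class U" "fstep U' a r i U" "U' \<in> reachable" "s' = key_class U'"
    unfolding btrans_ftrans[OF assms(1)] unfolding ftrans_def by blast
  moreover from this have "skel U' = skel R"
    using key_class_eqD[of U T] skel_key_equiv skel_fstep by metis
  ultimately show ?case by blast
qed

text \<open>Backward transitions are forward ones of the opposite pair, so exchanging
  \<open>s\<close> and \<open>s'\<close> swaps the two summands.\<close>

lemma ctmc_rate_eq: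
  assumes "\<forall>l. bk l = l"
  shows "ctmc_rate bk s s' = (\<Sum>(a, r)\<in>{(a, r). ftrans s a r s'}. r) + (\<Sum>(a, r)\<in>{(a, r). ftrans s' a r s}. r)"
  by (simp add: ctmc_rate_def btrans_ftrans[OF assms] finite_ftrans)

lemma sum_labels_nonneg: "0 \<le> (\<Sum>(a, r)\<in>{(a, r). ftrans s a r s'}. r)"
  by (rule sum_nonneg) (auto dest: ftrans_pos)

lemma ctmc_rate_nonneg: "\<forall>l. bk l = l \<Longrightarrow> 0 \<le> ctmc_rate bk s s'"
  by (simp add: ctmc_rate_eq sum_labels_nonneg)

lemma ctmc_rate_commute: "\<forall>l. bk l = l \<Longrightarrow> ctmc_rate bk s s' = ctmc_rate bk s' s"
  by (simp add: ctmc_rate_eq)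

lemma ctmc_rate_pos:
  assumes "\<forall>l. bk l = l" "ftrans s a r s'"
  shows "0 < ctmc_rate bk s s'"
proof -
  have "0 < (\<Sum>(a, r)\<in>{(a, r). ftrans s a r s'}. r)"
    using assms(2) by (intro sum_pos2[OF finite_ftrans, of "(a, r)"]) (auto dest: ftrans_pos)
  then show ?thesis
    using assms(1) sum_labels_nonneg[of s' s] by (simp add: ctmc_rate_eq)
qed

lemma ctmc_connected:
  fixes R :: "('a, 'b) proc"
  assumes id: "\<forall>l. bk l = l" and "A \<subseteq> ctmc_states bk R" "A \<noteq> {}"
    and closed: "\<And>s s'. s \<in> A \<Longrightarrow> s' \<in> ctmc_states bk R \<Longrightarrow> 0 < ctmc_rate bk s s' \<Longrightarrow> s' \<in> A"
  shows "A = ctmc_states bk R"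
proof -
  have rate: "0 < ctmc_rate bk s s'" "0 < ctmc_rate bk s' s" if "ftrans s a r s'" for s s' :: "('a, 'b) proc set" and a r
    using ctmc_rate_pos[OF id that] ctmc_rate_commute[OF id] by metis+
  \<comment> \<open>Every transition can be undone at positive rate, so a member of \<open>A\<close>
    can be followed back along its derivation to the initial class.\<close>
  have start: "key_class R \<in> A" if "s \<in> ctmc_states bk R" "s \<in> A" for s
    using that
  proof (induction rule: ctmc_states.induct)
    case (fwd s a r s')
    show ?case
      by (rule fwd.IH, rule closed[OF fwd.prems fwd.hyps(1)], rule rate(2)[OF fwd.hyps(2)])
  next
    case (bwd s a r s')
    show ?case
      by (rule bwd.IH, rule closed[OF bwd.prems bwd.hyps(1)])
         (rule rate(1)[OF bwd.hyps(2)[unfolded btrans_ftrans[OF id]]])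
  qed
  obtain s0 where s0: "s0 \<in> A" using assms(3) by (meson equals0I)
  \<comment> \<open>From the initial class, closedness reaches every state along its
    derivation.\<close>
  have "s \<in> A" if "s \<in> ctmc_states bk R" for s
    using that
  proof (induction rule: ctmc_states.induct)
    case init
    show ?case using start[OF subsetD[OF assms(2) s0] s0] .
  next
    case (fwd s a r s')
    show ?case
      by (rule closed[OF fwd.IH ctmc_states.fwd[OF fwd.hyps] rate(1)[OF fwd.hyps(2)]])
  next
    case (bwd s a r s')
    show ?case
      by (rule closed[OF bwd.IH ctmc_states.bwd[OF bwd.hyps]])
         (rule rate(2)[OF bwd.hyps(2)[unfolded btrans_ftrans[OF id]]])
  qed
  then show ?thesis by (intro antisym[OF assms(2)] subsetI)
qed

theorem theorem4p14:
  fixes bk :: "rate \<Rightarrow> rate"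
    and R :: "('a :: countable, 'k :: countable) proc"
  assumes "R \<in> reachable"
    and "\<forall>l. bk l = l"
  shows "ctmc_time_reversible (ctmc_states bk R) (ctmc_rate bk)"
proof (rule symmetric_ctmc_time_reversible)
  have "ctmc_states bk R \<subseteq> key_class ` {T \<in> reachable. skel T = skel R}"
    by (rule subsetI) (rule ctmc_states_skel[OF assms(2,1)])
  then show "finite (ctmc_states bk R)"
    by (rule finite_subset) (rule finite_key_classes)
  show "ctmc_states bk R \<noteq> {}"
    using ctmc_states.init[where bk = bk and R = R] by (metis emptyE)
  show "ctmc_rate bk s u = ctmc_rate bk u s" for s u :: "('a, 'k) proc set"
    by (rule ctmc_rate_commute[OF assms(2)])
  show "0 \<le> ctmc_rate bk s u" for s u :: "('a, 'k) proc set"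
    by (rule ctmc_rate_nonneg[OF assms(2)])
qed (rule ctmc_connected[OF assms(2)])

end
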